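(* For every positive integer $n$, $|B_n(132,213,312)|=\lfloor (n+1)/2\rfloor$.
   Context: A permutation $\sigma\in S_n$ is written as $\sigma(1)\cdots\sigma(n)$. An index $i\in[n-1]$ is an ascent if $\sigma(i)<\sigma(i+1)$ and a descent if $\sigma(i)>\sigma(i+1)$. A ballot permutation is a permutation such that every prefix $\sigma(1)\cdots\sigma(p)$ has at least as many ascents as descents. $\sigma$ contains a pattern $\pi\in S_k$ if some subsequence $\sigma(c_1)\cdots\sigma(c_k)$ with $c_1<\dots<c_k$ is order-isomorphic to $\pi$, and avoids $\pi$ otherwise. $B_n(\pi_1,\dots,\pi_m)$ denotes the set of ballot permutations of length $n$ avoiding all of $\pi_1,\dots,\pi_m$. *)

theory Defs
  imports Complex_Main "HOL-Combinatorics.Multiset_Permutations" "HOL-Library.Sublist"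
begin

text \<open>
  A permutation \<open>\<sigma>\<close> of \<open>[n]\<close> is represented by its word \<open>\<sigma>(1) \<dots> \<sigma>(n)\<close>, i.e. by an
  element of \<^term>\<open>permutations_of_set {1..n::nat}\<close>. Since list positions start at 0, the
  letter \<open>\<sigma>(i)\<close> is \<open>\<sigma> ! (i - 1)\<close>; ascents and descents are numbered from 1.
\<close>

definition ascents :: "nat list \<Rightarrow> nat set" where
  "ascents \<sigma> = {i \<in> {1..<length \<sigma>}. \<sigma> ! (i - 1) < \<sigma> ! i}"

definition descents :: "nat list \<Rightarrow> nat set" where
  "descents \<sigma> = {i \<in> {1..<length \<sigma>}. \<sigma> ! (i - 1) > \<sigma> ! i}"

definition ballot :: "nat list \<Rightarrow> bool" where
  "ballot \<sigma> \<longleftrightarrow> (\<forall>p \<in> {1..length \<sigma>}. card (ascents (take p \<sigma>)) \<ge> card (descents (take p \<sigma>)))"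

definition order_isomorphic :: "nat list \<Rightarrow> nat list \<Rightarrow> bool" where
  "order_isomorphic xs ys \<longleftrightarrow> length xs = length ys \<and>
     (\<forall>i < length xs. \<forall>j < length xs. xs ! i < xs ! j \<longleftrightarrow> ys ! i < ys ! j)"

definition contains_pattern :: "nat list \<Rightarrow> nat list \<Rightarrow> bool" where
  "contains_pattern \<sigma> \<pi> \<longleftrightarrow> (\<exists>\<tau>. subseq \<tau> \<sigma> \<and> order_isomorphic \<tau> \<pi>)"

definition avoids :: "nat list \<Rightarrow> nat list \<Rightarrow> bool" where
  "avoids \<sigma> \<pi> \<longleftrightarrow> \<not> contains_pattern \<sigma> \<pi>"

definition ballot_avoiding :: "nat \<Rightarrow> nat list set \<Rightarrow> nat list set" where
  "ballot_avoiding n P = {\<sigma> \<in> permutations_of_set {1..n}. ballot \<sigma> \<and> (\<forall>\<pi> \<in> P. avoids \<sigma> \<pi>)}"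

end

theory Submission
  imports Defs
begin

text \<open>
  Consider the entries around the maximum \<open>n\<close>. Avoiding 213 makes the entries before \<open>n\<close> increase,
  avoiding 312 makes those after it decrease, and avoiding 132 makes every entry before \<open>n\<close> exceed
  every entry after it. Hence the word is \<open>(d+1) \<dots> n d (d-1) \<dots> 1\<close> for some \<open>d < n\<close>. It has
  \<open>n - 1 - d\<close> ascents followed by \<open>d\<close> descents, so it is ballot iff \<open>2 d < n\<close>.
\<close>

definition peak_word :: "nat \<Rightarrow> nat \<Rightarrow> nat list" where
  "peak_word n d = [Suc d..<Suc n] @ rev [1..<Suc d]"

lemma order_isomorphic_length3:
  "order_isomorphic [a, b, c] [x, y, z] \<longleftrightarrow>
     (a < b \<longleftrightarrow> x < y) \<and> (b < a \<longleftrightarrow> y < x) \<and> (a < c \<longleftrightarrow> x < z) \<and>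
     (c < a \<longleftrightarrow> z < x) \<and> (b < c \<longleftrightarrow> y < z) \<and> (c < b \<longleftrightarrow> z < y)"
  by (auto simp: order_isomorphic_def All_less_Suc numeral_3_eq_3)

lemma contains_pattern_length3:
  "contains_pattern \<sigma> [x, y, z] \<longleftrightarrow>
     (\<exists>a b c. subseq [a, b, c] \<sigma> \<and> order_isomorphic [a, b, c] [x, y, z])"
proof
  assume "contains_pattern \<sigma> [x, y, z]"
  then obtain \<tau> where "subseq \<tau> \<sigma>" "order_isomorphic \<tau> [x, y, z]"
    by (auto simp: contains_pattern_def)
  moreover from this have "length \<tau> = Suc (Suc (Suc 0))"
    by (simp add: order_isomorphic_def)
  ultimately show "\<exists>a b c. subseq [a, b, c] \<sigma> \<and> order_isomorphic [a, b, c] [x, y, z]"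
    by (auto simp: length_Suc_conv)
qed (auto simp: contains_pattern_def)

lemma length_peak_word [simp]: "d \<le> n \<Longrightarrow> length (peak_word n d) = n"
  by (simp add: peak_word_def del: upt_Suc)

lemma peak_word_nth:
  assumes "d \<le> n" "i < n"
  shows "peak_word n d ! i = (if i < n - d then Suc (d + i) else n - i)"
  using assms by (auto simp: peak_word_def nth_append rev_nth simp del: upt_Suc)

lemma peak_word_permutation:
  assumes "d \<le> n"
  shows "peak_word n d \<in> permutations_of_set {1..n}"
  using assms by (auto simp: peak_word_def permutations_of_set_def simp del: upt_Suc)

text \<open>Counting positions from 1, the peak \<open>n\<close> stands at position
  \<open>n - d\<close>, so every index below it is an ascent and every later one a descent. Taking
  \<open>p\<close> letters keeps exactly the indices below \<open>p\<close>.\<close>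

lemma ascents_take_peak_word:
  assumes "d < n" "p \<le> n"
  shows "ascents (take p (peak_word n d)) = {1..<min p (n - d)}"
  using assms by (auto simp: ascents_def peak_word_nth split: if_splits) arith+

lemma descents_take_peak_word:
  assumes "d < n" "p \<le> n"
  shows "descents (take p (peak_word n d)) = {n - d..<p}"
  using assms by (auto simp: descents_def peak_word_nth split: if_splits) arith+

text \<open>Since all ascents precede all descents, the surplus of ascents only falls once a descent
  has occurred. A violation at any prefix therefore persists to the whole word, where
  \<open>d\<close> descents face \<open>n - d - 1\<close> ascents.\<close>

lemma ballot_peak_word:
  assumes "d < n"
  shows "ballot (peak_word n d) \<longleftrightarrow> 2 * d < n"
proof
  assume "ballot (peak_word n d)"
  with assms have "\<forall>p\<in>{1..n}. card (descents (take p (peak_word n d)))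
      \<le> card (ascents (take p (peak_word n d)))"
    by (simp add: ballot_def)
  then have "card (descents (take n (peak_word n d))) \<le> card (ascents (take n (peak_word n d)))"
    by (rule bspec) (use assms in simp)
  with assms show "2 * d < n"
    by (simp only: ascents_take_peak_word descents_take_peak_word order_refl card_atLeastLessThan)
next
  assume "2 * d < n"
  then show "ballot (peak_word n d)"
    using assms by (auto simp: ballot_def ascents_take_peak_word descents_take_peak_word)
qed

lemma set_subset_if_subseq: "subseq xs ys \<Longrightarrow> set xs \<subseteq> set ys"
  by (auto elim: list_emb_set)

lemma sorted_wrt_subseq: "subseq xs ys \<Longrightarrow> sorted_wrt P ys \<Longrightarrow> sorted_wrt P xs"
  by (induction rule: list_emb.induct) (auto dest: set_subset_if_subseq)

text \<open>The three alternatives are the patterns 123, 231 and 321, the complement in S_3 of the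
  forbidden ones. They arise according to how many of the three letters come from the increasing
  block: three, two, or at most one.\<close>

lemma subseq_peak_word_length3:
  assumes "subseq [a, b, c] (peak_word n d)"
  shows "a < b \<and> b < c \<or> a < b \<and> c < a \<or> b < a \<and> c < b"
proof -
  from assms obtain us vs where uv: "[a, b, c] = us @ vs"
    and us: "subseq us [Suc d..<Suc n]" and vs: "subseq vs (rev [1..<Suc d])"
    unfolding peak_word_def by (auto elim: subseq_appendE)
  have "sorted_wrt (<) us"
    using us by (rule sorted_wrt_subseq) (rule sorted_wrt_upt)
  moreover have "sorted_wrt (>) vs"
    using vs by (rule sorted_wrt_subseq) (simp only: sorted_wrt_rev sorted_wrt_upt)
  \<comment> \<open>Letters of the first block exceed \<open>d\<close>, those of the second are at
    most \<open>d\<close>.\<close>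
  moreover have "\<forall>x\<in>set us. \<forall>y\<in>set vs. y < x"
    using set_subset_if_subseq[OF us] set_subset_if_subseq[OF vs]
    by (fastforce simp del: upt_Suc)
  ultimately show ?thesis
    using uv by (auto simp: Cons_eq_append_conv)
qed

lemma peak_word_avoids:
  "\<forall>\<pi>\<in>{[1,3,2], [2,1,3], [3,1,2]}. avoids (peak_word n d) \<pi>"
  by (auto simp: avoids_def contains_pattern_length3 order_isomorphic_length3
      dest!: subseq_peak_word_length3)

lemma subseq_pair_if_nth:
  assumes "i < j" "j < length xs"
  shows "subseq [xs ! i, xs ! j] xs"
proof -
  have "xs = take j xs @ xs ! j # drop (Suc j) xs"
    using assms by (simp add: id_take_nth_drop)
  moreover have "subseq [xs ! i] (take j xs)"
    using assms by (auto simp: subseq_singleton_left in_set_conv_nth)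
  moreover have "subseq [xs ! j] (xs ! j # drop (Suc j) xs)"
    by simp
  ultimately show ?thesis
    by (metis append_Cons append_Nil list_emb_append_mono)
qed

lemma avoider_is_peak_word:
  assumes "n \<ge> 1" and perm: "\<sigma> \<in> permutations_of_set {1..n}"
    and av: "\<forall>\<pi>\<in>{[1,3,2], [2,1,3], [3,1,2]}. avoids \<sigma> \<pi>"
  obtains d where "d < n" "\<sigma> = peak_word n d"
proof -
  have set: "set \<sigma> = {1..n}" and dist: "distinct \<sigma>"
    using perm by (auto simp: permutations_of_set_def)
  have "n \<in> set \<sigma>"
    using \<open>n \<ge> 1\<close> set by simp
  then obtain xs ys where \<sigma>: "\<sigma> = xs @ n # ys"
    by (auto simp: in_set_conv_decomp)
  have below: "x < n" if "x \<in> set xs \<union> set ys" for x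
  proof -
    have "x \<in> set \<sigma>" "x \<noteq> n"
      using that dist \<sigma> by auto
    then show ?thesis
      unfolding set by simp
  qed
  have no: "\<not> order_isomorphic [a, b, c] \<pi>"
    if "subseq [a, b, c] \<sigma>" "\<pi> \<in> {[1,3,2], [2,1,3], [3,1,2]}" for a b c \<pi>
    using av that unfolding avoids_def contains_pattern_def by blast
  have no132: False if "subseq [a, b, c] \<sigma>" "a < c" "c < b" for a b c
    using no[OF that(1), of "[1,3,2]"] that(2,3) by (simp add: order_isomorphic_length3)
  have no213: False if "subseq [a, b, c] \<sigma>" "b < a" "a < c" for a b c
    using no[OF that(1), of "[2,1,3]"] that(2,3) by (simp add: order_isomorphic_length3)
  have no312: False if "subseq [a, b, c] \<sigma>" "b < c" "c < a" for a b c
    using no[OF that(1), of "[3,1,2]"] that(2,3) by (simp add: order_isomorphic_length3)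
  have inc: "sorted_wrt (<) xs"
    unfolding sorted_wrt_iff_nth_less
  proof (intro allI impI)
    fix i j assume ij: "i < j" "j < length xs"
    \<comment> \<open>A descent inside \<open>xs\<close>, followed by \<open>n\<close> in the role
      of 3, would be a 213.\<close>
    then have "subseq ([xs ! i, xs ! j] @ [n]) (xs @ n # ys)"
      by (intro list_emb_append_mono subseq_pair_if_nth) auto
    then have "\<not> xs ! j < xs ! i"
      using no213[of "xs ! i" "xs ! j" n] below[of "xs ! i"] ij \<sigma> by auto
    moreover have "xs ! i \<noteq> xs ! j"
      using dist ij \<sigma> by (auto simp: nth_eq_iff_index_eq)
    ultimately show "xs ! i < xs ! j" by simp
  qed
  have dec: "sorted_wrt (>) ys"
    unfolding sorted_wrt_iff_nth_less
  proof (intro allI impI)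
    fix i j assume ij: "i < j" "j < length ys"
    \<comment> \<open>An ascent inside \<open>ys\<close>, preceded by \<open>n\<close> in the role
      of 3, would be a 312.\<close>
    then have "subseq ([] @ n # [ys ! i, ys ! j]) (xs @ n # ys)"
      by (intro list_emb_append_mono) (auto intro: subseq_pair_if_nth)
    then have "\<not> ys ! i < ys ! j"
      using no312[of n "ys ! i" "ys ! j"] below[of "ys ! j"] ij \<sigma> by auto
    moreover have "ys ! i \<noteq> ys ! j"
      using dist ij \<sigma> by (auto simp: nth_eq_iff_index_eq)
    ultimately show "ys ! j < ys ! i" by simp
  qed
  have sep: "y < x" if "x \<in> set xs" "y \<in> set ys" for x y
  proof -
    have "subseq ([x] @ n # [y]) (xs @ n # ys)"
      using that by (intro list_emb_append_mono) (auto simp: subseq_singleton_left)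
    then have "\<not> x < y"
      using no132[of x n y] below[of y] that \<sigma> by auto
    moreover have "x \<noteq> y"
      using dist that \<sigma> by auto
    ultimately show ?thesis by simp
  qed
  \<comment> \<open>The three order facts combine into a single sorted list: a strictly increasing
    list is determined by its set, so this rearrangement of the word must be 1, ..., n.\<close>
  have "sorted_wrt (<) (rev ys @ xs @ [n])"
    unfolding sorted_wrt_append sorted_wrt_rev using inc dec sep below
    by (auto intro: less_trans)
  moreover have "set (rev ys @ xs @ [n]) = set [1..<Suc n]"
    using set unfolding \<sigma> set_upt atLeastLessThanSuc_atLeastAtMost by auto
  ultimately have eq: "rev ys @ xs @ [n] = [1..<Suc n]"
    by (rule strict_sorted_equal[OF sorted_wrt_upt])
  define d where "d = length ys"
  have "length \<sigma> = n"
    using distinct_card[OF dist] set by simp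
  then have "d < n"
    by (simp add: \<sigma> d_def)
  \<comment> \<open>Cutting 1, ..., n after \<open>d = length ys\<close> letters lets the two sides
    of \<open>eq\<close> be compared block by block.\<close>
  then have "[1..<Suc n] = [1..<Suc d] @ [Suc d..<Suc n]"
    using upt_add_eq_append[of 1 "Suc d" "n - d"] by (simp del: upt_Suc)
  with eq have "rev ys = [1..<Suc d]" "xs @ [n] = [Suc d..<Suc n]"
    by (auto simp: append_eq_append_conv d_def simp del: upt_Suc)
  then have "\<sigma> = peak_word n d"
    unfolding \<sigma> peak_word_def by (metis append.assoc append_Cons append_Nil rev_rev_ident)
  with \<open>d < n\<close> show thesis by (rule that)
qed

lemma ballot_avoiding_eq:
  assumes "n \<ge> 1"
  shows "ballot_avoiding n {[1,3,2], [2,1,3], [3,1,2]} = peak_word n ` {d. 2 * d < n}"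
    (is "?L = ?R")
proof
  show "?L \<subseteq> ?R"
  proof
    fix \<sigma> assume "\<sigma> \<in> ?L"
    then have "\<sigma> \<in> permutations_of_set {1..n}" "ballot \<sigma>"
      "\<forall>\<pi>\<in>{[1,3,2], [2,1,3], [3,1,2]}. avoids \<sigma> \<pi>"
      by (auto simp: ballot_avoiding_def)
    with assms show "\<sigma> \<in> ?R"
      by (metis avoider_is_peak_word ballot_peak_word imageI mem_Collect_eq)
  qed
  show "?R \<subseteq> ?L"
    using peak_word_avoids
    by (auto simp: ballot_avoiding_def ballot_peak_word peak_word_permutation simp del: One_nat_def)
qed

text \<open>The first letter is \<open>d + 1\<close>, which recovers \<open>d\<close>. The bound
  \<open>d < n\<close> matters: for positive \<open>n\<close>, the values \<open>d = n\<close> and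
  \<open>d = n - 1\<close> both give the decreasing word.\<close>

lemma inj_on_peak_word: "inj_on (peak_word n) {d. d < n}"
proof (rule inj_onI)
  fix d e assume "d \<in> {d. d < n}" "e \<in> {d. d < n}" "peak_word n d = peak_word n e"
  then have "peak_word n d ! 0 = peak_word n e ! 0" "d < n" "e < n"
    by auto
  then show "d = e"
    by (simp add: peak_word_nth)
qed

theorem theorem4p4:
  fixes n :: nat
  assumes "n \<ge> 1"
  shows "int (card (ballot_avoiding n {[1,3,2], [2,1,3], [3,1,2]})) = \<lfloor>(real n + 1) / 2\<rfloor>"
proof -
  have "inj_on (peak_word n) {d. 2 * d < n}"
    by (rule inj_on_subset[OF inj_on_peak_word]) auto
  \<comment> \<open>The admissible \<open>d\<close> are those below n/2, and there are n/2 rounded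
    up of them.\<close>
  moreover have "{d. 2 * d < n} = {..<(n + 1) div 2}"
    by auto
  ultimately have "card (ballot_avoiding n {[1,3,2], [2,1,3], [3,1,2]}) = (n + 1) div 2"
    using assms by (simp add: ballot_avoiding_eq card_image del: One_nat_def)
  moreover have "\<lfloor>(real n + 1) / 2\<rfloor> = int ((n + 1) div 2)"
    using floor_divide_of_nat_eq[of "n + 1" 2, where ?'a = real] by (simp add: add.commute)
  ultimately show ?thesis
    by simp
qed

end
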